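(* Let $V=V^{(1)}\otimes\cdots\otimes V^{(d)}$ be a tensor product of finite dimensional complex Hilbert spaces, and let $T\in V$ be a tensor that has a diagonal singular value decomposition. Then the singular values of $T$ are uniquely determined by $T$: if $T=\sum_{j=1}^r\sigma_jv_j$ and $T=\sum_{i=1}^s\lambda_iw_i$ are two diagonal singular value decompositions of $T$, then $r=s$ and $\sigma_i=\lambda_i$ for all $i$.
   Context: $V$ carries the Hilbert space structure with $\langle v^{(1)}\otimes\cdots\otimes v^{(d)},w^{(1)}\otimes\cdots\otimes w^{(d)}\rangle=\prod_e\langle v^{(e)},w^{(e)}\rangle$. A pure tensor in $V$ is an element of the form $v^{(1)}\otimes\cdots\otimes v^{(d)}$ with $v^{(e)}\in V^{(e)}$. For an $r$-tuple $\mathbf{S}=(S_1,\dots,S_r)$ of tensors in $V$ and $\alpha>0$, $[\mathbf{S}]_\alpha$ is the maximum of $\big(\sum_{i=1}^r|\langle S_i,u\rangle|^\alpha\big)^{1/\alpha}$ over all pure tensors $u\in V$ of unit length. For real $t\geq 1$, an $r$-tuple $\mathbf{S}$ of tensors of unit length is called $t$-orthogonal if $[\mathbf{S}]_{2/t}=1$. A diagonal singular value decomposition of $T$ is a decomposition $T=\sum_{i=1}^r\sigma_iv_i$ where $\sigma_1\geq\sigma_2\geq\cdots\geq\sigma_r>0$ are real and $(v_1,\dots,v_r)$ is a $2$-orthogonal $r$-tuple of pure tensors of unit length; $\sigma_1,\dots,\sigma_r$ are called its singular values. *)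

theory Defs
  imports Complex_Main "HOL-Library.FuncSet"
begin

text \<open>
  A finite dimensional complex Hilbert space is given as a subspace S of an ambient complex vector
  space together with an inner product ip on S (linear in the first argument). Finitely many
  spaces can always be placed in one ambient space, namely their direct sum. Completeness is
  automatic in finite dimension.
\<close>

locale fd_hilbert_space = vector_space scale
  for scale :: "complex \<Rightarrow> 'a::ab_group_add \<Rightarrow> 'a" +
  fixes S :: "'a set" and ip :: "'a \<Rightarrow> 'a \<Rightarrow> complex"
  assumes subspace: "subspace S"
    and finite_dim: "\<exists>B. finite B \<and> span B = S"
    and ip_add: "\<lbrakk>x \<in> S; y \<in> S; z \<in> S\<rbrakk> \<Longrightarrow> ip (x + y) z = ip x z + ip y z"
    and ip_scale: "\<lbrakk>x \<in> S; y \<in> S\<rbrakk> \<Longrightarrow> ip (scale a x) y = a * ip x y"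
    and ip_cnj: "\<lbrakk>x \<in> S; y \<in> S\<rbrakk> \<Longrightarrow> ip y x = cnj (ip x y)"
    and ip_pos: "\<lbrakk>x \<in> S; x \<noteq> 0\<rbrakk> \<Longrightarrow> Re (ip x x) > 0"

definition hnorm :: "('a \<Rightarrow> 'a \<Rightarrow> complex) \<Rightarrow> 'a \<Rightarrow> real" where
  "hnorm ip x = sqrt (Re (ip x x))"

text \<open>
  The tensor product of the spaces H e (for e from 1 to d): a Hilbert space V that is spanned by
  the values of a multilinear map \<open>tens\<close>, where \<open>tens x\<close> stands for the pure tensor of
  x 1, ..., x d, and whose inner product is the product of the inner products on pure tensors.
  The latter condition makes the pure tensors of orthonormal bases orthonormal, hence linearly
  independent, so that V is the algebraic tensor product, and it determines the inner product.
  Thus V is determined up to a unique isometry compatible with \<open>tens\<close>.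
\<close>

locale tensor_product = V: fd_hilbert_space scaleV V ipV
  for d :: nat
    and scaleH :: "complex \<Rightarrow> 'a::ab_group_add \<Rightarrow> 'a"
    and H :: "nat \<Rightarrow> 'a set"
    and ipH :: "nat \<Rightarrow> 'a \<Rightarrow> 'a \<Rightarrow> complex"
    and scaleV :: "complex \<Rightarrow> 'v::ab_group_add \<Rightarrow> 'v"
    and V :: "'v set"
    and ipV :: "'v \<Rightarrow> 'v \<Rightarrow> complex"
    and tens :: "(nat \<Rightarrow> 'a) \<Rightarrow> 'v" +
  assumes d_pos: "d \<ge> 1"
    and factors: "e \<in> {1..d} \<Longrightarrow> fd_hilbert_space scaleH (H e) (ipH e)"
    and tens_add: "\<lbrakk>x \<in> (\<Pi>\<^sub>E e\<in>{1..d}. H e); e \<in> {1..d}; a \<in> H e; b \<in> H e\<rbrakk> \<Longrightarrow>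
      tens (x(e := a + b)) = tens (x(e := a)) + tens (x(e := b))"
    and tens_scale: "\<lbrakk>x \<in> (\<Pi>\<^sub>E e\<in>{1..d}. H e); e \<in> {1..d}; a \<in> H e\<rbrakk> \<Longrightarrow>
      tens (x(e := scaleH c a)) = scaleV c (tens (x(e := a)))"
    and tens_span: "V.span (tens ` (\<Pi>\<^sub>E e\<in>{1..d}. H e)) = V"
    and tens_ip: "\<lbrakk>x \<in> (\<Pi>\<^sub>E e\<in>{1..d}. H e); y \<in> (\<Pi>\<^sub>E e\<in>{1..d}. H e)\<rbrakk> \<Longrightarrow>
      ipV (tens x) (tens y) = (\<Prod>e\<in>{1..d}. ipH e (x e) (y e))"

definition pure_tensors :: "nat \<Rightarrow> (nat \<Rightarrow> 'a set) \<Rightarrow> ((nat \<Rightarrow> 'a) \<Rightarrow> 'v) \<Rightarrow> 'v set" where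
  "pure_tensors d H tens = tens ` (\<Pi>\<^sub>E e\<in>{1..d}. H e)"

text \<open>
  In the following P is the set of pure tensors and \<open>(X 1, \<dots>, X r)\<close> is the r-tuple of tensors.
  The supremum is a maximum: the unit vectors of the finite dimensional factors form compact sets,
  so the pure tensors of unit length do as well.
\<close>

definition bracket ::
    "'v set \<Rightarrow> ('v \<Rightarrow> 'v \<Rightarrow> complex) \<Rightarrow> real \<Rightarrow> nat \<Rightarrow> (nat \<Rightarrow> 'v) \<Rightarrow> real" where
  "bracket P ip \<alpha> r X =
     (SUP u\<in>{u \<in> P. hnorm ip u = 1}. (\<Sum>i=1..r. cmod (ip (X i) u) powr \<alpha>) powr (1 / \<alpha>))"

definition t_orthogonal ::
    "'v set \<Rightarrow> 'v set \<Rightarrow> ('v \<Rightarrow> 'v \<Rightarrow> complex) \<Rightarrow> real \<Rightarrow> nat \<Rightarrow> (nat \<Rightarrow> 'v) \<Rightarrow> bool" where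
  "t_orthogonal V P ip t r X \<longleftrightarrow>
     t \<ge> 1 \<and> (\<forall>i\<in>{1..r}. X i \<in> V \<and> hnorm ip (X i) = 1) \<and> bracket P ip (2 / t) r X = 1"

definition diagonal_svd ::
    "(complex \<Rightarrow> 'v::ab_group_add \<Rightarrow> 'v) \<Rightarrow> 'v set \<Rightarrow> 'v set \<Rightarrow> ('v \<Rightarrow> 'v \<Rightarrow> complex) \<Rightarrow>
     'v \<Rightarrow> nat \<Rightarrow> (nat \<Rightarrow> real) \<Rightarrow> (nat \<Rightarrow> 'v) \<Rightarrow> bool" where
  "diagonal_svd scaleV V P ip T r \<sigma> v \<longleftrightarrow>
     T = (\<Sum>i=1..r. scaleV (complex_of_real (\<sigma> i)) (v i)) \<and>
     (\<forall>i\<in>{1..r}. \<sigma> i > 0) \<and>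
     (\<forall>i\<in>{1..r}. \<forall>j\<in>{1..r}. i \<le> j \<longrightarrow> \<sigma> i \<ge> \<sigma> j) \<and>
     (\<forall>i\<in>{1..r}. v i \<in> P) \<and>
     t_orthogonal V P ip 2 r v"

end

theory Submission
  imports Defs
begin

text \<open>
  Both v and w consist of unit pure tensors, so the bracket bounds say that the matrix
  \<open>\<bar>\<langle>w j, v i\<rangle>\<bar>\<close> has all row and column sums at most 1. They also make v and w orthonormal, so pairing
  \<open>T = \<Sum>j. \<tau> j w j\<close> with \<open>v i\<close> gives \<open>\<sigma> i \<le> \<Sum>j. \<bar>\<langle>w j, v i\<rangle>\<bar> \<tau> j\<close>. Hence \<sigma> is weakly majorized by \<tau>
  and, by symmetry, \<tau> by \<sigma>; all partial sums of the two decreasing sequences agree.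
\<close>

text \<open>The weights with which \<open>\<tau>\<close> enters the first \<open>min k r\<close>
  bounds are partial column sums: each lies in [0,1] and their total is at most \<open>k\<close>.
  Among such weights a decreasing nonnegative sequence gives the largest weighted sum when the first
  \<open>k\<close> terms get weight 1.\<close>

lemma weak_majorization:
  fixes \<sigma> \<tau> :: "nat \<Rightarrow> real" and m :: "nat \<Rightarrow> nat \<Rightarrow> real"
  assumes nonneg: "\<And>i j. i \<in> {1..r} \<Longrightarrow> j \<in> {1..s} \<Longrightarrow> 0 \<le> m i j"
    and rows: "\<And>i. i \<in> {1..r} \<Longrightarrow> (\<Sum>j=1..s. m i j) \<le> 1"
    and cols: "\<And>j. j \<in> {1..s} \<Longrightarrow> (\<Sum>i=1..r. m i j) \<le> 1"
    and pos: "\<And>j. j \<in> {1..s} \<Longrightarrow> 0 \<le> \<tau> j"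
    and dec: "\<And>i j. i \<in> {1..s} \<Longrightarrow> j \<in> {1..s} \<Longrightarrow> i \<le> j \<Longrightarrow> \<tau> j \<le> \<tau> i"
    and le: "\<And>i. i \<in> {1..r} \<Longrightarrow> \<sigma> i \<le> (\<Sum>j=1..s. m i j * \<tau> j)"
  shows "(\<Sum>i=1..min k r. \<sigma> i) \<le> (\<Sum>j=1..min k s. \<tau> j)"
proof (cases "k = 0")
  case False
  \<comment> \<open>A threshold separating the first \<open>k\<close> values of
    \<open>\<tau>\<close> from the later ones: \<open>\<tau> j - x\<close> is nonnegative up to
    index \<open>k\<close> and nonpositive beyond. For \<open>k > s\<close> nothing lies beyond, and
    the value 0 extends \<open>\<tau>\<close> past its end.\<close>
  define x where "x = (if k \<le> s then \<tau> k else 0)"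
  define c where "c j = (\<Sum>i=1..min k r. m i j)" for j
  have x_nonneg: "0 \<le> x"
    using False pos by (auto simp: x_def)
  have c_nonneg: "0 \<le> c j" if "j \<in> {1..s}" for j
    using that nonneg by (auto simp: c_def intro!: sum_nonneg)
  have c_le: "c j \<le> 1" if "j \<in> {1..s}" for j
  proof -
    have "c j \<le> (\<Sum>i=1..r. m i j)"
      unfolding c_def using that nonneg by (intro sum_mono2) auto
    with cols[OF that] show ?thesis by simp
  qed
  have "(\<Sum>j=1..s. c j) = (\<Sum>i=1..min k r. \<Sum>j=1..s. m i j)"
    unfolding c_def by (rule sum.swap)
  also have "\<dots> \<le> (\<Sum>i=1..min k r. 1)"
    using rows by (intro sum_mono) auto
  finally have c_sum: "(\<Sum>j=1..s. c j) \<le> k" by simp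
  have above: "x \<le> \<tau> j" if "j \<in> {1..min k s}" for j
    using that pos dec[of j k] False by (auto simp: x_def)
  have below: "\<tau> j \<le> x" if "j \<in> {1..s} - {1..min k s}" for j
    using that dec[of k j] False by (auto simp: x_def)
  have "(\<Sum>i=1..min k r. \<sigma> i) \<le> (\<Sum>i=1..min k r. \<Sum>j=1..s. m i j * \<tau> j)"
    using le by (intro sum_mono) auto
  also have "\<dots> = (\<Sum>j=1..s. c j * \<tau> j)"
    unfolding c_def sum_distrib_right by (rule sum.swap)
  \<comment> \<open>Splitting off the threshold lets the bound on the total weight control the
    second summand, while the signs of \<open>\<tau> j - x\<close> control the first: weights rise
    to 1 where the sign is nonnegative, and terms are dropped where it is nonpositive.\<close>
  also have "\<dots> = (\<Sum>j=1..s. c j * (\<tau> j - x)) + x * (\<Sum>j=1..s. c j)"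
    by (simp add: algebra_simps sum.distrib sum_subtractf sum_distrib_left)
  also have "\<dots> \<le> (\<Sum>j=1..min k s. \<tau> j - x) + x * k"
  proof (rule add_mono)
    have "(\<Sum>j=1..s. c j * (\<tau> j - x))
        = (\<Sum>j\<in>{1..s} - {1..min k s}. c j * (\<tau> j - x)) + (\<Sum>j=1..min k s. c j * (\<tau> j - x))"
      by (rule sum.subset_diff) auto
    also have "(\<Sum>j\<in>{1..s} - {1..min k s}. c j * (\<tau> j - x)) \<le> 0"
      using c_nonneg below by (intro sum_nonpos mult_nonneg_nonpos) (auto simp del: Diff_iff)
    also have "(\<Sum>j=1..min k s. c j * (\<tau> j - x)) \<le> (\<Sum>j=1..min k s. \<tau> j - x)"
      using c_le c_nonneg above by (intro sum_mono mult_left_le_one_le) auto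
    finally show "(\<Sum>j=1..s. c j * (\<tau> j - x)) \<le> (\<Sum>j=1..min k s. \<tau> j - x)" by simp
  qed (use c_sum x_nonneg in \<open>intro mult_left_mono\<close>)
  \<comment> \<open>For \<open>k \<le> s\<close> the \<open>k\<close> subtracted copies of
    \<open>x\<close> cancel \<open>x * k\<close>; for \<open>k > s\<close> the threshold is
    0.\<close>
  also have "\<dots> = (\<Sum>j=1..min k s. \<tau> j)"
    by (auto simp: sum_subtractf x_def min_def)
  finally show ?thesis .
qed simp

text \<open>Differences of consecutive partial sums recover both sequences extended by 0. Positivity
  then fixes the length: at the first index past the shorter sequence, a 0 would have to equal a
  positive value.\<close>

lemma eq_of_partial_sums_eq:
  fixes \<sigma> \<tau> :: "nat \<Rightarrow> real"
  assumes sums: "\<And>k. (\<Sum>i=1..min k r. \<sigma> i) = (\<Sum>j=1..min k s. \<tau> j)"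
    and \<sigma>_pos: "\<And>i. i \<in> {1..r} \<Longrightarrow> 0 < \<sigma> i"
    and \<tau>_pos: "\<And>i. i \<in> {1..s} \<Longrightarrow> 0 < \<tau> i"
  shows "r = s \<and> (\<forall>i\<in>{1..r}. \<sigma> i = \<tau> i)"
proof -
  have step: "(\<Sum>i=1..min (Suc k) n. f i) = (\<Sum>i=1..min k n. f i) + (if Suc k \<le> n then f (Suc k) else 0)"
    for f :: "nat \<Rightarrow> real" and k n
    by (auto simp: min_def not_less_eq_eq le_Suc_eq)
  have eq: "(if Suc k \<le> r then \<sigma> (Suc k) else 0) = (if Suc k \<le> s then \<tau> (Suc k) else 0)" for k
    using sums[of "Suc k"] sums[of k] unfolding step by simp
  have "r = s"
  proof (rule linorder_cases[of r s])
    assume "r < s"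
    then show ?thesis using eq[of r] \<tau>_pos[of "Suc r"] by auto
  next
    assume "s < r"
    then show ?thesis using eq[of s] \<sigma>_pos[of "Suc s"] by auto
  qed
  moreover have "\<sigma> i = \<tau> i" if "i \<in> {1..r}" for i
    using eq[of "i - 1"] that \<open>r = s\<close> by auto
  ultimately show ?thesis by blast
qed

context fd_hilbert_space
begin

lemma ip_self_eq_1:
  assumes "x \<in> S" "hnorm ip x = 1"
  shows "ip x x = 1"
proof -
  have "Re (ip x x) = 1" using assms(2) by (simp add: hnorm_def)
  moreover have "Im (ip x x) = 0" using ip_cnj[OF assms(1) assms(1)] by (simp add: complex_eq_iff)
  ultimately show ?thesis by (simp add: complex_eq_iff)
qed

lemma ip_zero_left:
  assumes "y \<in> S"
  shows "ip 0 y = 0"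
  using ip_scale[OF assms assms, of 0] by simp

lemma ip_sum_scale_left:
  assumes "finite I" "\<And>i. i \<in> I \<Longrightarrow> x i \<in> S" "y \<in> S"
  shows "ip (\<Sum>i\<in>I. scale (a i) (x i)) y = (\<Sum>i\<in>I. a i * ip (x i) y)"
  using assms
proof (induction I rule: finite_induct)
  case (insert i I)
  have "scale (a i) (x i) \<in> S" "(\<Sum>i\<in>I. scale (a i) (x i)) \<in> S"
    using insert.prems subspace by (auto intro!: subspace_sum subspace_scale)
  then show ?case using insert by (simp add: ip_add ip_scale)
qed (simp add: ip_zero_left)

lemma cmod_ip_commute:
  assumes "x \<in> S" "y \<in> S"
  shows "cmod (ip x y) = cmod (ip y x)"
  using ip_cnj[OF assms] by simp

text \<open>Cauchy-Schwarz for unit vectors: the component \<open>z\<close> of \<open>x\<close>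
  orthogonal to \<open>y\<close> has squared norm \<open>1 - (cmod c)\<^sup>2\<close>, which cannot
  be negative.\<close>

lemma cmod_ip_le_1:
  assumes x: "x \<in> S" "hnorm ip x = 1" and y: "y \<in> S" "hnorm ip y = 1"
  shows "cmod (ip x y) \<le> 1"
proof -
  define c where "c = ip x y"
  define z where "z = x + scale (- c) y"
  have cy: "scale (- c) y \<in> S" by (rule subspace_scale[OF subspace y(1)])
  have z: "z \<in> S" unfolding z_def by (rule subspace_add[OF subspace x(1) cy])
  have zl: "ip z u = ip x u - c * ip y u" if "u \<in> S" for u
    unfolding z_def using x(1) cy y(1) that by (simp only: ip_add ip_scale) simp
  have "ip z y = 0"
    using zl[OF y(1)] ip_self_eq_1[OF y] by (simp add: c_def)
  moreover have "ip z x = 1 - c * cnj c"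
    using zl[OF x(1)] ip_self_eq_1[OF x] ip_cnj[OF x(1) y(1)] by (simp add: c_def)
  ultimately have "ip z z = 1 - cnj c * c"
    using zl[OF z] ip_cnj[OF z x(1)] ip_cnj[OF z y(1)] by simp
  then have "Re (ip z z) = 1 - (cmod c)\<^sup>2"
    unfolding cmod_power2 by (simp add: power2_eq_square)
  moreover have "0 \<le> Re (ip z z)"
    using ip_pos[OF z] ip_zero_left[OF z] by (cases "z = 0") auto
  ultimately have "(cmod c)\<^sup>2 \<le> 1\<^sup>2" by simp
  then show ?thesis unfolding c_def by (rule power2_le_imp_le) simp
qed

text \<open>A real supremum bounds its members once the set is known to be bounded above; here
  Cauchy-Schwarz supplies the bound \<open>r\<close>. For t = 2 the exponent 2/t is 1, so the powers
  in \<open>bracket\<close> disappear.\<close>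

lemma t_orthogonal_2_sum_le_1:
  assumes orth: "t_orthogonal S P ip 2 r X" and "P \<subseteq> S" and u: "u \<in> P" "hnorm ip u = 1"
  shows "(\<Sum>i=1..r. cmod (ip (X i) u)) \<le> 1"
proof -
  define U where "U = {u \<in> P. hnorm ip u = 1}"
  define f where "f u = (\<Sum>i=1..r. cmod (ip (X i) u) powr 1) powr 1" for u
  have f: "f u = (\<Sum>i=1..r. cmod (ip (X i) u))" for u
    by (simp add: f_def sum_nonneg)
  have X: "X i \<in> S" "hnorm ip (X i) = 1" if "i \<in> {1..r}" for i
    using orth that by (auto simp: t_orthogonal_def)
  have "f x \<le> r" if "x \<in> U" for x
  proof -
    have "f x \<le> (\<Sum>i=1..r. 1)"
      unfolding f using that \<open>P \<subseteq> S\<close> X by (intro sum_mono cmod_ip_le_1) (auto simp: U_def)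
    then show ?thesis by simp
  qed
  then have "bdd_above (f ` U)" by (rule bdd_aboveI2)
  moreover have "u \<in> U" using u by (simp add: U_def)
  ultimately have "f u \<le> (SUP u\<in>U. f u)" by (rule cSUP_upper[rotated])
  also have "\<dots> = bracket P ip (2 / 2) r X" by (simp add: bracket_def U_def f_def)
  also have "\<dots> = 1" using orth by (simp only: t_orthogonal_def)
  finally show ?thesis by (simp add: f)
qed

text \<open>Test the sum bound on the unit pure tensor \<open>X j\<close> itself: the term at
  \<open>j\<close> already contributes 1, leaving no room for any other term.\<close>

lemma t_orthogonal_2_ip:
  assumes orth: "t_orthogonal S P ip 2 r X" and "P \<subseteq> S" and "X ` {1..r} \<subseteq> P"
    and ij: "i \<in> {1..r}" "j \<in> {1..r}"
  shows "ip (X i) (X j) = (if i = j then 1 else 0)"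
proof -
  have X: "X j \<in> S" "hnorm ip (X j) = 1" "X j \<in> P"
    using orth assms(3) ij by (auto simp: t_orthogonal_def)
  note jj = ip_self_eq_1[OF X(1,2)]
  have "(\<Sum>l=1..r. cmod (ip (X l) (X j)))
      = cmod (ip (X j) (X j)) + (\<Sum>l\<in>{1..r} - {j}. cmod (ip (X l) (X j)))"
    using ij by (intro sum.remove) auto
  moreover have "(\<Sum>l=1..r. cmod (ip (X l) (X j))) \<le> 1"
    using t_orthogonal_2_sum_le_1[OF orth \<open>P \<subseteq> S\<close> X(3,2)] .
  ultimately have le: "(\<Sum>l\<in>{1..r} - {j}. cmod (ip (X l) (X j))) \<le> 0" using jj by simp
  show ?thesis
  proof (cases "i = j")
    case False
    then have "cmod (ip (X i) (X j)) \<le> (\<Sum>l\<in>{1..r} - {j}. cmod (ip (X l) (X j)))"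
      using ij by (intro member_le_sum) auto
    with le have "cmod (ip (X i) (X j)) \<le> 0" by linarith
    with False show ?thesis by simp
  qed (simp add: jj)
qed

lemma diagonal_svd_partial_sum_le:
  assumes v: "diagonal_svd scale S P ip T r \<sigma> v" and w: "diagonal_svd scale S P ip T s \<tau> w"
    and "P \<subseteq> S"
  shows "(\<Sum>i=1..min k r. \<sigma> i) \<le> (\<Sum>j=1..min k s. \<tau> j)"
proof (rule weak_majorization[where m = "\<lambda>i j. cmod (ip (w j) (v i))"])
  have ov: "t_orthogonal S P ip 2 r v" and ow: "t_orthogonal S P ip 2 s w"
    and Tv: "T = (\<Sum>i=1..r. scale (complex_of_real (\<sigma> i)) (v i))"
    and Tw: "T = (\<Sum>j=1..s. scale (complex_of_real (\<tau> j)) (w j))"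
    using v w by (simp_all only: diagonal_svd_def)
  have vP: "v i \<in> P" "v i \<in> S" "hnorm ip (v i) = 1" "0 < \<sigma> i" if "i \<in> {1..r}" for i
    using v that by (auto simp: diagonal_svd_def t_orthogonal_def)
  have wP: "w j \<in> P" "w j \<in> S" "hnorm ip (w j) = 1" "0 < \<tau> j" if "j \<in> {1..s}" for j
    using w that by (auto simp: diagonal_svd_def t_orthogonal_def)
  show "(\<Sum>j=1..s. cmod (ip (w j) (v i))) \<le> 1" if "i \<in> {1..r}" for i
    using t_orthogonal_2_sum_le_1[OF ow \<open>P \<subseteq> S\<close>] vP that by blast
  show "(\<Sum>i=1..r. cmod (ip (w j) (v i))) \<le> 1" if "j \<in> {1..s}" for j
  proof -
    \<comment> \<open>Columns are bounded by testing the tuple \<open>v\<close> on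
      \<open>w j\<close>, which needs the arguments of \<open>ip\<close> exchanged; the modulus is
      unaffected by the conjugation.\<close>
    have "(\<Sum>i=1..r. cmod (ip (w j) (v i))) = (\<Sum>i=1..r. cmod (ip (v i) (w j)))"
      using vP wP that by (intro sum.cong cmod_ip_commute) auto
    also have "\<dots> \<le> 1"
      using t_orthogonal_2_sum_le_1[OF ov \<open>P \<subseteq> S\<close>] wP that by blast
    finally show ?thesis .
  qed
  show "0 \<le> \<tau> j" if "j \<in> {1..s}" for j using wP(4)[OF that] by simp
  show "\<tau> j \<le> \<tau> i" if "i \<in> {1..s}" "j \<in> {1..s}" "i \<le> j" for i j
    using w that by (auto simp: diagonal_svd_def)
  show "\<sigma> i \<le> (\<Sum>j=1..s. cmod (ip (w j) (v i)) * \<tau> j)" if i: "i \<in> {1..r}" for i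
  proof -
    have "v ` {1..r} \<subseteq> P" using vP by auto
    note orth = t_orthogonal_2_ip[OF ov \<open>P \<subseteq> S\<close> this]
    \<comment> \<open>The number \<open>ip T (v i)\<close> is computed from both decompositions:
      orthonormality of \<open>v\<close> isolates \<open>\<sigma> i\<close>, and the expansion in
      \<open>w\<close> is then estimated by the triangle inequality.\<close>
    have "ip T (v i) = (\<Sum>l=1..r. complex_of_real (\<sigma> l) * ip (v l) (v i))"
      unfolding Tv using vP i by (intro ip_sum_scale_left) auto
    also have "\<dots> = (\<Sum>l=1..r. if l = i then complex_of_real (\<sigma> l) else 0)"
      using orth i by (intro sum.cong) auto
    also have "\<dots> = complex_of_real (\<sigma> i)" using i by simp
    finally have "complex_of_real (\<sigma> i) = ip T (v i)" ..
    also have "\<dots> = (\<Sum>j=1..s. complex_of_real (\<tau> j) * ip (w j) (v i))"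
      unfolding Tw using vP wP i by (intro ip_sum_scale_left) auto
    finally have eq: "complex_of_real (\<sigma> i) = (\<Sum>j=1..s. complex_of_real (\<tau> j) * ip (w j) (v i))" .
    have "\<sigma> i = cmod (complex_of_real (\<sigma> i))" using vP(4)[OF i] by simp
    also have "\<dots> \<le> (\<Sum>j=1..s. cmod (complex_of_real (\<tau> j) * ip (w j) (v i)))"
      unfolding eq by (rule norm_sum)
    also have "\<dots> = (\<Sum>j=1..s. cmod (ip (w j) (v i)) * \<tau> j)"
      using wP(4) by (intro sum.cong) (auto simp: norm_mult less_imp_le)
    finally show ?thesis .
  qed
qed simp

end

theorem theorem1p5:
  fixes d :: nat
    and scaleH :: "complex \<Rightarrow> 'a::ab_group_add \<Rightarrow> 'a"
    and H :: "nat \<Rightarrow> 'a set"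
    and ipH :: "nat \<Rightarrow> 'a \<Rightarrow> 'a \<Rightarrow> complex"
    and scaleV :: "complex \<Rightarrow> 'v::ab_group_add \<Rightarrow> 'v"
    and V :: "'v set"
    and ipV :: "'v \<Rightarrow> 'v \<Rightarrow> complex"
    and tens :: "(nat \<Rightarrow> 'a) \<Rightarrow> 'v"
    and T :: 'v
    and r s :: nat
    and \<sigma> \<tau> :: "nat \<Rightarrow> real"
    and v w :: "nat \<Rightarrow> 'v"
  assumes "tensor_product d scaleH H ipH scaleV V ipV tens"
    and "T \<in> V"
    and "diagonal_svd scaleV V (pure_tensors d H tens) ipV T r \<sigma> v"
    and "diagonal_svd scaleV V (pure_tensors d H tens) ipV T s \<tau> w"
  shows "r = s \<and> (\<forall>i\<in>{1..r}. \<sigma> i = \<tau> i)"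
proof (rule eq_of_partial_sums_eq)
  interpret tensor_product d scaleH H ipH scaleV V ipV tens by (rule assms(1))
  have "pure_tensors d H tens \<subseteq> V"
    unfolding pure_tensors_def using V.span_superset tens_span by blast
  \<comment> \<open>The one-sided comparison is applied twice, with the two decompositions
    exchanged.\<close>
  then show "(\<Sum>i=1..min k r. \<sigma> i) = (\<Sum>j=1..min k s. \<tau> j)" for k
    using assms(3,4) by (intro antisym V.diagonal_svd_partial_sum_le)
qed (use assms(3,4) in \<open>auto simp: diagonal_svd_def\<close>)

end
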